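(* Let $\mathcal{S}$ be a structural couniform abstract logic in a propositional language $\mathcal{L}$. Then its Lindenbaum atlas $\mathbf{Lin}_{\mathcal{S}}[\Sigma_{\mathcal{S}}]$ is couniform.
   Context: $\mathcal{L}$ is an abstract propositional language, given by a set $\mathcal{V}_{\mathcal{L}}$ of variables, a set of constants and a set of finitary connectives. $\mathbf{Fm}_{\mathcal{L}}$ is the set of all $\mathcal{L}$-formulae, also viewed as the formula algebra; $\mathcal{V}(\alpha)$ is the set of variables occurring in $\alpha$, and $\mathcal{V}(X)=\bigcup_{\alpha\in X}\mathcal{V}(\alpha)$ for $X\subseteq\mathbf{Fm}_{\mathcal{L}}$. A structural abstract logic $\mathcal{S}$ is given by a (not necessarily finitary) consequence relation $\vdash_{\mathcal{S}}$ on $\mathbf{Fm}_{\mathcal{L}}$ (reflexive, monotone, transitive/closed under cut) closed under substitutions, equivalently by its consequence operator $\mathbf{Cn}_{\mathcal{S}}(X)=\{\alpha : X\vdash_{\mathcal{S}}\alpha\}$. A set $X$ is consistent if $\mathbf{Cn}_{\mathcal{S}}(X)\neq\mathbf{Fm}_{\mathcal{L}}$. An $\mathcal{S}$-theory is a set $X$ with $\mathbf{Cn}_{\mathcal{S}}(X)=X$; $\Sigma_{\mathcal{S}}$ is the set of all $\mathcal{S}$-theories. $\mathcal{S}$ is couniform if for any collection $\{X_i\}_{i\in I}$ of formula sets with $\mathcal{V}(X_i)\cap\mathcal{V}(X_{i'})=\varnothing$ for $i\neq i'$ and $\mathcal{V}(\bigcup_{i\in I}X_i)\neq\mathcal{V}_{\mathcal{L}}$: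 if $\bigcup_{i\in I}X_i$ is inconsistent, then at least one $X_i$ is inconsistent. An $\mathcal{L}$-matrix is a pair $\mathbf{M}=\langle\mathbf{A},D\rangle$ with $\mathbf{A}$ an algebra of the signature of $\mathcal{L}$ and $D\subseteq|\mathbf{A}|$ (its logical filter). A valuation in $\mathbf{A}$ is a homomorphism from the formula algebra to $\mathbf{A}$. $\mathfrak{S}(\mathbf{M})$ is the set of all $X\subseteq\mathbf{Fm}_{\mathcal{L}}$ such that $X=\{\alpha\in\mathbf{Fm}_{\mathcal{L}} : v[\alpha]\in D\}$ for some valuation $v$ in $\mathbf{A}$. An atlas is a pair $\langle\mathbf{A},\{D_i\}_{i\in I}\rangle$ with each $D_i\subseteq|\mathbf{A}|$; its corresponding bundle is the family of matrices $\{\langle\mathbf{A},D_i\rangle\}_{i\in I}$. The Lindenbaum atlas of $\mathcal{S}$ is $\mathbf{Lin}_{\mathcal{S}}[\Sigma_{\mathcal{S}}]=\langle\mathbf{Fm}_{\mathcal{L}},\Sigma_{\mathcal{S}}\rangle$. A nonempty set $\{\mathbf{M}_j\}_{j\in J}$ of $\mathcal{L}$-matrices is couniform if for any collection $\{X_i\}_{i\in I}$ of formula sets with $\mathcal{V}(X_i)\cap\mathcal{V}(X_{i'})=\varnothing$ for $i\neq i'$ and $\mathcal{V}(\bigcup_{i\in I}X_i)\neq\mathcal{V}_{\mathcal{L}}$: if for every $i\in I$ there are $j\in J$ and $Z_j\in\mathfrak{S}(\mathbf{M}_j)$ with $X_i\subseteq Z_j\subsetneq\mathbf{Fm}_{\mathcal{L}}$,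 then there are $k\in J$ and $Z_k\in\mathfrak{S}(\mathbf{M}_k)$ with $\bigcup_{i\in I}X_i\subseteq Z_k\subsetneq\mathbf{Fm}_{\mathcal{L}}$. An atlas is couniform if its corresponding bundle is couniform. *)

theory Defs
  imports Main
begin

section \<open>Propositional languages and formulas\<close>

record ('v, 'c, 'f) language =
  variables :: "'v set"
  constants :: "'c set"
  connectives :: "'f set"
  arity :: "'f \<Rightarrow> nat"

datatype (vars_fm: 'v, consts_fm: 'c, conns_fm: 'f) fm =
    Var 'v
  | Const 'c
  | Conn 'f "('v, 'c, 'f) fm list"

inductive_set Fm :: "('v, 'c, 'f) language \<Rightarrow> ('v, 'c, 'f) fm set"
  for L :: "('v, 'c, 'f) language" where
  Var: "p \<in> variables L \<Longrightarrow> Var p \<in> Fm L"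
| Const: "c \<in> constants L \<Longrightarrow> Const c \<in> Fm L"
| Conn: "f \<in> connectives L \<Longrightarrow> length as = arity L f \<Longrightarrow> (\<And>a. a \<in> set as \<Longrightarrow> a \<in> Fm L)
    \<Longrightarrow> Conn f as \<in> Fm L"

definition vars_set :: "('v, 'c, 'f) fm set \<Rightarrow> 'v set" where
  "vars_set X = (\<Union>\<alpha>\<in>X. vars_fm \<alpha>)"


section \<open>Algebras, homomorphisms, matrices\<close>

text \<open>The operations are total functions on the underlying types; their values are relevant only
  on symbols of the language and on argument lists of the right length from the universe.\<close>

record ('c, 'f, 'a) algebra =
  universe :: "'a set"
  const_op :: "'c \<Rightarrow> 'a"
  conn_op :: "'f \<Rightarrow> 'a list \<Rightarrow> 'a"

definition is_algebra :: "('v, 'c, 'f) language \<Rightarrow> ('c, 'f, 'a) algebra \<Rightarrow> bool" where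
  "is_algebra L A \<longleftrightarrow>
     (\<forall>c\<in>constants L. const_op A c \<in> universe A) \<and>
     (\<forall>f\<in>connectives L. \<forall>as. length as = arity L f \<and> set as \<subseteq> universe A
        \<longrightarrow> conn_op A f as \<in> universe A)"

definition is_hom :: "('v, 'c, 'f) language \<Rightarrow> ('c, 'f, 'a) algebra \<Rightarrow> ('c, 'f, 'b) algebra
    \<Rightarrow> ('a \<Rightarrow> 'b) \<Rightarrow> bool" where
  "is_hom L A B h \<longleftrightarrow>
     (\<forall>x\<in>universe A. h x \<in> universe B) \<and>
     (\<forall>c\<in>constants L. h (const_op A c) = const_op B c) \<and>
     (\<forall>f\<in>connectives L. \<forall>as. length as = arity L f \<and> set as \<subseteq> universe A
        \<longrightarrow> h (conn_op A f as) = conn_op B f (map h as))"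

definition fm_algebra :: "('v, 'c, 'f) language \<Rightarrow> ('c, 'f, ('v, 'c, 'f) fm) algebra" where
  "fm_algebra L = \<lparr>universe = Fm L, const_op = Const, conn_op = Conn\<rparr>"

definition valuation :: "('v, 'c, 'f) language \<Rightarrow> ('c, 'f, 'a) algebra
    \<Rightarrow> (('v, 'c, 'f) fm \<Rightarrow> 'a) \<Rightarrow> bool" where
  "valuation L A v \<longleftrightarrow> is_hom L (fm_algebra L) A v"

definition substitution :: "('v, 'c, 'f) language \<Rightarrow> (('v, 'c, 'f) fm \<Rightarrow> ('v, 'c, 'f) fm) \<Rightarrow> bool" where
  "substitution L s \<longleftrightarrow> is_hom L (fm_algebra L) (fm_algebra L) s"

type_synonym ('c, 'f, 'a) lmatrix = "('c, 'f, 'a) algebra \<times> 'a set"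

definition is_matrix :: "('v, 'c, 'f) language \<Rightarrow> ('c, 'f, 'a) lmatrix \<Rightarrow> bool" where
  "is_matrix L M \<longleftrightarrow> is_algebra L (fst M) \<and> snd M \<subseteq> universe (fst M)"

definition matrix_sets :: "('v, 'c, 'f) language \<Rightarrow> ('c, 'f, 'a) lmatrix
    \<Rightarrow> ('v, 'c, 'f) fm set set" where
  "matrix_sets L M = {X. \<exists>v. valuation L (fst M) v \<and> X = {\<alpha> \<in> Fm L. v \<alpha> \<in> snd M}}"


section \<open>Abstract logics\<close>

text \<open>A consequence relation is only considered on subsets and elements of \<open>Fm L\<close>; whatever it
  says about other arguments is disregarded.\<close>

type_synonym ('v, 'c, 'f) conseq = "('v, 'c, 'f) fm set \<Rightarrow> ('v, 'c, 'f) fm \<Rightarrow> bool"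

definition abstract_logic :: "('v, 'c, 'f) language \<Rightarrow> ('v, 'c, 'f) conseq \<Rightarrow> bool" where
  "abstract_logic L S \<longleftrightarrow>
     (\<forall>X \<alpha>. X \<subseteq> Fm L \<and> \<alpha> \<in> X \<longrightarrow> S X \<alpha>) \<and>
     (\<forall>X Y \<alpha>. X \<subseteq> Y \<and> Y \<subseteq> Fm L \<and> \<alpha> \<in> Fm L \<and> S X \<alpha> \<longrightarrow> S Y \<alpha>) \<and>
     (\<forall>X Y Z \<alpha>. X \<subseteq> Fm L \<and> Y \<subseteq> Fm L \<and> Z \<subseteq> Fm L \<and> \<alpha> \<in> Fm L
        \<and> (\<forall>\<beta>\<in>Y. S X \<beta>) \<and> S (Y \<union> Z) \<alpha> \<longrightarrow> S (X \<union> Z) \<alpha>)"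

definition structural :: "('v, 'c, 'f) language \<Rightarrow> ('v, 'c, 'f) conseq \<Rightarrow> bool" where
  "structural L S \<longleftrightarrow>
     (\<forall>s X \<alpha>. substitution L s \<and> X \<subseteq> Fm L \<and> \<alpha> \<in> Fm L \<and> S X \<alpha> \<longrightarrow> S (s ` X) (s \<alpha>))"

definition Cn :: "('v, 'c, 'f) language \<Rightarrow> ('v, 'c, 'f) conseq
    \<Rightarrow> ('v, 'c, 'f) fm set \<Rightarrow> ('v, 'c, 'f) fm set" where
  "Cn L S X = {\<alpha> \<in> Fm L. S X \<alpha>}"

definition consistent :: "('v, 'c, 'f) language \<Rightarrow> ('v, 'c, 'f) conseq
    \<Rightarrow> ('v, 'c, 'f) fm set \<Rightarrow> bool" where
  "consistent L S X \<longleftrightarrow> Cn L S X \<noteq> Fm L"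

definition theories :: "('v, 'c, 'f) language \<Rightarrow> ('v, 'c, 'f) conseq
    \<Rightarrow> ('v, 'c, 'f) fm set set" where
  "theories L S = {X. X \<subseteq> Fm L \<and> Cn L S X = X}"


section \<open>Couniformity\<close>

definition var_disjoint_family :: "('v, 'c, 'f) language \<Rightarrow> 'i set \<Rightarrow> ('i \<Rightarrow> ('v, 'c, 'f) fm set)
    \<Rightarrow> bool" where
  "var_disjoint_family L I X \<longleftrightarrow>
     (\<forall>i\<in>I. X i \<subseteq> Fm L) \<and>
     (\<forall>i\<in>I. \<forall>i'\<in>I. i \<noteq> i' \<longrightarrow> vars_set (X i) \<inter> vars_set (X i') = {}) \<and>
     vars_set (\<Union>i\<in>I. X i) \<noteq> variables L"

text \<open>A definition cannot quantify over all index types. In both notions of couniformity indices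
  are taken from the type of sets of formulas, which loses nothing, because a family may be
  reindexed by its own members: the lemmas \<open>couniform_any_index\<close> and
  \<open>couniform_matrices_any_index\<close> give the defining property for every index type.\<close>

definition couniform :: "('v, 'c, 'f) language \<Rightarrow> ('v, 'c, 'f) conseq \<Rightarrow> bool" where
  "couniform L S \<longleftrightarrow>
     (\<forall>(I :: ('v, 'c, 'f) fm set set) X. var_disjoint_family L I X \<longrightarrow>
        \<not> consistent L S (\<Union>i\<in>I. X i) \<longrightarrow> (\<exists>i\<in>I. \<not> consistent L S (X i)))"

definition couniform_matrices :: "('v, 'c, 'f) language \<Rightarrow> ('c, 'f, 'a) lmatrix set \<Rightarrow> bool" where
  "couniform_matrices L \<M> \<longleftrightarrow>
     \<M> \<noteq> {} \<and> (\<forall>M\<in>\<M>. is_matrix L M) \<and>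
     (\<forall>(I :: ('v, 'c, 'f) fm set set) X. var_disjoint_family L I X \<longrightarrow>
        (\<forall>i\<in>I. \<exists>M\<in>\<M>. \<exists>Z\<in>matrix_sets L M. X i \<subseteq> Z \<and> Z \<subset> Fm L) \<longrightarrow>
        (\<exists>M\<in>\<M>. \<exists>Z\<in>matrix_sets L M. (\<Union>i\<in>I. X i) \<subseteq> Z \<and> Z \<subset> Fm L))"

lemma var_disjoint_family_image:
  assumes "var_disjoint_family L I X"
  shows "var_disjoint_family L (X ` I) (\<lambda>Y. Y)"
  unfolding var_disjoint_family_def
proof (intro conjI ballI impI)
  fix Y Y' assume "Y \<in> X ` I" "Y' \<in> X ` I" "Y \<noteq> Y'"
  then obtain i i' where "i \<in> I" "i' \<in> I" "i \<noteq> i'" "Y = X i" "Y' = X i'" by auto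
  with assms show "vars_set Y \<inter> vars_set Y' = {}"
    unfolding var_disjoint_family_def by simp
qed (use assms in \<open>auto simp: var_disjoint_family_def\<close>)

lemma couniform_any_index:
  fixes I :: "'i set"
  assumes "couniform L S" "var_disjoint_family L I X" "\<not> consistent L S (\<Union>i\<in>I. X i)"
  shows "\<exists>i\<in>I. \<not> consistent L S (X i)"
proof -
  have "\<exists>Y\<in>X ` I. \<not> consistent L S Y"
    using assms(1)[unfolded couniform_def, rule_format, OF var_disjoint_family_image[OF assms(2)]]
      assms(3) by simp
  then show ?thesis by simp
qed

lemma couniform_matrices_any_index:
  fixes I :: "'i set"
  assumes "couniform_matrices L \<M>" "var_disjoint_family L I X"
    and "\<And>i. i \<in> I \<Longrightarrow> \<exists>M\<in>\<M>. \<exists>Z\<in>matrix_sets L M. X i \<subseteq> Z \<and> Z \<subset> Fm L"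
  shows "\<exists>M\<in>\<M>. \<exists>Z\<in>matrix_sets L M. (\<Union>i\<in>I. X i) \<subseteq> Z \<and> Z \<subset> Fm L"
proof -
  have "\<forall>Y\<in>X ` I. \<exists>M\<in>\<M>. \<exists>Z\<in>matrix_sets L M. Y \<subseteq> Z \<and> Z \<subset> Fm L"
    using assms(3) by (simp only: ball_simps) simp
  from mp[OF assms(1)[unfolded couniform_matrices_def, THEN conjunct2, THEN conjunct2,
      THEN spec, THEN spec, THEN mp, OF var_disjoint_family_image[OF assms(2)]] this]
  show ?thesis by (simp only: image_ident)
qed


section \<open>Atlases\<close>

text \<open>The family of logical filters enters an atlas only through the set of its members.\<close>

type_synonym ('c, 'f, 'a) atlas = "('c, 'f, 'a) algebra \<times> 'a set set"

definition atlas_bundle :: "('c, 'f, 'a) atlas \<Rightarrow> ('c, 'f, 'a) lmatrix set" where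
  "atlas_bundle At = {(fst At, D) | D. D \<in> snd At}"

definition couniform_atlas :: "('v, 'c, 'f) language \<Rightarrow> ('c, 'f, 'a) atlas \<Rightarrow> bool" where
  "couniform_atlas L At \<longleftrightarrow> couniform_matrices L (atlas_bundle At)"

definition lindenbaum_atlas :: "('v, 'c, 'f) language \<Rightarrow> ('v, 'c, 'f) conseq
    \<Rightarrow> ('c, 'f, ('v, 'c, 'f) fm) atlas" where
  "lindenbaum_atlas L S = (fm_algebra L, theories L S)"

end

theory Submission
  imports Defs
begin

text \<open>Preimages of theories under substitutions are theories, by structurality, and the identity
  substitution gives back every theory. So the sets defined by the Lindenbaum bundle are exactly the
  theories, and being contained in a proper one of them means being consistent; couniformity of
  the bundle is thus couniformity of the logic.\<close>

lemma abstract_logic_mono: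
  assumes "abstract_logic L S" "X \<subseteq> Y" "Y \<subseteq> Fm L" "\<alpha> \<in> Fm L" "S X \<alpha>"
  shows "S Y \<alpha>"
  using assms(1)[unfolded abstract_logic_def, THEN conjunct2, THEN conjunct1, rule_format, of X Y \<alpha>]
    assms(2-5) by simp

lemma abstract_logic_cut:
  assumes "abstract_logic L S" "X \<subseteq> Fm L" "Y \<subseteq> Fm L" "\<alpha> \<in> Fm L"
    and "\<And>\<beta>. \<beta> \<in> Y \<Longrightarrow> S X \<beta>" "S Y \<alpha>"
  shows "S X \<alpha>"
  using assms(1)[unfolded abstract_logic_def, THEN conjunct2, THEN conjunct2, rule_format, of X Y "{}" \<alpha>]
    assms(2-6) by simp

lemma Cn_mono:
  assumes "abstract_logic L S" "X \<subseteq> Y" "Y \<subseteq> Fm L"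
  shows "Cn L S X \<subseteq> Cn L S Y"
  using abstract_logic_mono[OF assms] by (auto simp: Cn_def)

lemma Cn_subset_Fm: "Cn L S X \<subseteq> Fm L"
  by (auto simp: Cn_def)

lemma subset_Cn:
  assumes "abstract_logic L S" "X \<subseteq> Fm L"
  shows "X \<subseteq> Cn L S X"
  using assms(1)[unfolded abstract_logic_def, THEN conjunct1] assms(2) by (auto simp: Cn_def)

text \<open>This is idempotence of \<open>Cn\<close>: every member of \<open>Cn L S X\<close>
  follows from \<open>X\<close>, so cut applies with \<open>Cn L S X\<close> as the intermediate
  set.\<close>

lemma Cn_in_theories:
  assumes "abstract_logic L S" "X \<subseteq> Fm L"
  shows "Cn L S X \<in> theories L S"
proof -
  have "\<alpha> \<in> Cn L S X" if "\<alpha> \<in> Cn L S (Cn L S X)" for \<alpha>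
    using abstract_logic_cut[OF assms Cn_subset_Fm[of L S X], of \<alpha>] that by (simp add: Cn_def)
  then show ?thesis
    using Cn_subset_Fm[of L S X] subset_Cn[OF assms(1) Cn_subset_Fm[of L S X]]
    unfolding theories_def by blast
qed

lemma substitution_vimage_in_theories:
  assumes "abstract_logic L S" "structural L S" "substitution L s" "D \<in> theories L S"
  shows "{\<alpha> \<in> Fm L. s \<alpha> \<in> D} \<in> theories L S"
proof -
  let ?Z = "{\<alpha> \<in> Fm L. s \<alpha> \<in> D}"
  have D: "D \<subseteq> Fm L" "Cn L S D = D"
    using assms(4) by (auto simp: theories_def)
  have "\<alpha> \<in> ?Z" if "\<alpha> \<in> Cn L S ?Z" for \<alpha>
  proof -
    have \<alpha>: "\<alpha> \<in> Fm L" "S ?Z \<alpha>"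
      using that by (auto simp: Cn_def)
    then have "S (s ` ?Z) (s \<alpha>)"
      using assms(2)[unfolded structural_def, rule_format, of s ?Z \<alpha>] assms(3) by simp
    moreover have "s \<alpha> \<in> Fm L"
      using assms(3) \<alpha>(1) by (simp add: substitution_def is_hom_def fm_algebra_def)
    ultimately have "s \<alpha> \<in> Cn L S (s ` ?Z)"
      by (simp add: Cn_def)
    \<comment> \<open>The image of the preimage \<open>?Z\<close> under \<open>s\<close> lies in
      \<open>D\<close>, so monotonicity takes \<open>s \<alpha>\<close> into the closure of
      \<open>D\<close>, which is \<open>D\<close> itself.\<close>
    also have "\<dots> \<subseteq> Cn L S D"
      by (rule Cn_mono[OF assms(1) _ D(1)]) auto
    finally show ?thesis
      using \<alpha>(1) D(2) by simp
  qed
  then show ?thesis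
    using subset_Cn[OF assms(1), of ?Z, OF Collect_restrict] Collect_restrict[of "Fm L"]
    unfolding theories_def by blast
qed

text \<open>Couniformity of a bundle asks only whether some matrix in it defines a suitable set,
  never which one. Hence the union over the bundle carries all the information required.\<close>

lemma matrix_sets_lindenbaum:
  assumes "abstract_logic L S" "structural L S"
  shows "(\<Union>M\<in>atlas_bundle (lindenbaum_atlas L S). matrix_sets L M) = theories L S"
proof -
  have id: "valuation L (fm_algebra L) (\<lambda>\<alpha>. \<alpha>)"
    by (simp add: valuation_def is_hom_def)
  have "D \<in> matrix_sets L (fm_algebra L, D)" if "D \<in> theories L S" for D
  proof -
    \<comment> \<open>Restricting to formulas loses nothing, because a theory is a subset of
      \<open>Fm L\<close>.\<close>
    have "D = {\<alpha> \<in> Fm L. \<alpha> \<in> D}"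
      using that by (auto simp: theories_def)
    with id show ?thesis
      unfolding matrix_sets_def fst_conv snd_conv by blast
  qed
  \<comment> \<open>A valuation in the formula algebra is the same thing as a substitution, so the
    sets defined here are preimages of \<open>D\<close>.\<close>
  moreover have "matrix_sets L (fm_algebra L, D) \<subseteq> theories L S" if "D \<in> theories L S" for D
    using substitution_vimage_in_theories[OF assms _ that]
    by (auto simp: matrix_sets_def valuation_def substitution_def)
  ultimately show ?thesis
    unfolding atlas_bundle_def lindenbaum_atlas_def fst_conv snd_conv by blast
qed

text \<open>\<open>Cn L S X\<close> is the least theory containing \<open>X\<close>: it is the
  witness in one direction, and in the other it lies below any given proper theory.\<close>

lemma consistent_iff_subset_proper_theory:
  assumes "abstract_logic L S" "X \<subseteq> Fm L"
  shows "consistent L S X \<longleftrightarrow> (\<exists>Z\<in>theories L S. X \<subseteq> Z \<and> Z \<subset> Fm L)"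
proof
  assume "consistent L S X"
  then have "Cn L S X \<subset> Fm L"
    using Cn_subset_Fm[of L S X] unfolding consistent_def by blast
  then show "\<exists>Z\<in>theories L S. X \<subseteq> Z \<and> Z \<subset> Fm L"
    using Cn_in_theories[OF assms] subset_Cn[OF assms] by blast
next
  assume "\<exists>Z\<in>theories L S. X \<subseteq> Z \<and> Z \<subset> Fm L"
  then obtain Z where Z: "Cn L S Z = Z" "X \<subseteq> Z" "Z \<subset> Fm L"
    by (auto simp: theories_def)
  then have "Cn L S X \<subseteq> Z"
    using Cn_mono[OF assms(1), of X Z] by auto
  with Z(3) show "consistent L S X"
    unfolding consistent_def by blast
qed

lemma is_algebra_fm_algebra: "is_algebra L (fm_algebra L)"
  by (auto simp: is_algebra_def fm_algebra_def intro: Fm.intros)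

theorem proposition3p2:
  fixes L :: "('v, 'c, 'f) language" and S :: "('v, 'c, 'f) conseq"
  assumes "abstract_logic L S" and "structural L S" and "couniform L S"
  shows "couniform_atlas L (lindenbaum_atlas L S)"
proof -
  let ?B = "atlas_bundle (lindenbaum_atlas L S)"
  have char: "(\<exists>M\<in>?B. \<exists>Z\<in>matrix_sets L M. X \<subseteq> Z \<and> Z \<subset> Fm L) \<longleftrightarrow> consistent L S X"
    if "X \<subseteq> Fm L" for X
    unfolding consistent_iff_subset_proper_theory[OF assms(1) that]
      matrix_sets_lindenbaum[OF assms(1,2), symmetric] by blast
  \<comment> \<open>The closure of the empty set is a theory whether or not the logic is consistent,
    so the bundle always has a member.\<close>
  have "?B \<noteq> {}"
    using Cn_in_theories[OF assms(1) empty_subsetI]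
    by (auto simp: atlas_bundle_def lindenbaum_atlas_def)
  moreover have "\<forall>M\<in>?B. is_matrix L M"
    using is_algebra_fm_algebra
    by (auto simp: atlas_bundle_def lindenbaum_atlas_def is_matrix_def theories_def fm_algebra_def)
  moreover have "\<exists>M\<in>?B. \<exists>Z\<in>matrix_sets L M. (\<Union>i\<in>I. X i) \<subseteq> Z \<and> Z \<subset> Fm L"
    if fam: "var_disjoint_family L I X"
      and ex: "\<forall>i\<in>I. \<exists>M\<in>?B. \<exists>Z\<in>matrix_sets L M. X i \<subseteq> Z \<and> Z \<subset> Fm L"
    for I :: "('v, 'c, 'f) fm set set" and X
  proof -
    have sub: "X i \<subseteq> Fm L" if "i \<in> I" for i
      using fam that unfolding var_disjoint_family_def by blast
    have "consistent L S (X i)" if "i \<in> I" for i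
      using ex that char[OF sub] by blast
    \<comment> \<open>This is couniformity of the logic in contrapositive form. An empty
      \<open>I\<close> needs no separate case: couniformity then yields consistency of the empty
      set.\<close>
    then have "consistent L S (\<Union>i\<in>I. X i)"
      using couniform_any_index[OF assms(3) fam] by blast
    then show ?thesis
      using char[OF UN_least[of I X, OF sub]] by blast
  qed
  ultimately show ?thesis
    unfolding couniform_atlas_def couniform_matrices_def by blast
qed

end
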